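(* Let $m\ge 1$, $I=\{1,\dots,m\}$, let $\{U_i\}_{i\in I}$ be a family of linear subspaces of $\mathbb{R}^n$, and let $S=\bigcap_{i\in I}U_i$. Let $A:\mathbb{R}^n\to\mathbb{R}^n$ be the auxiliary averaged operator and $C:\mathbb{R}^n\to\mathbb{R}^n$ the circumcentered--reflection operator associated with $U_1,\dots,U_m$, both defined in the context. Then there is a constant $r_A\in[0,1)$, independent of the starting point, which satisfies $$\|A(y)-P_S(y)\|\le r_A\|y-P_S(y)\|\quad\text{for all } y\in\mathbb{R}^n,$$ and such that, for every $x\in\mathbb{R}^n$, the sequence $\{C^k(x)\}_{k\in\mathbb{N}}$ converges to $P_S(x)$ with the linear rate $r_A$.
   Context: $\mathbb{R}^n$ carries the standard scalar product and Euclidean norm $\|\cdot\|$. For a linear or affine subspace $V$, $P_V$ denotes the orthogonal projection onto $V$; for a linear subspace $V$, $R_V=2P_V-\mathrm{Id}$ is the reflection onto $V$. No relation between $m$ and $n$ is required. For $x\in\mathbb{R}^n$ and $i\in I$ put $x^{(i)}=R_{U_i}\cdots R_{U_2}R_{U_1}(x)$, and let $W_x=\operatorname{aff}\{x,x^{(1)},\dots,x^{(m)}\}$ (affine hull). Circumcentered--reflection operator: $C(x)$ is the (unique, well-defined) point such that (a) $C(x)\in W_x$ and (b) $C(x)$ is equidistant to the points $x,x^{(1)},\dots,x^{(m)}$, i.e. $\|C(x)-x\|=\|C(x)-x^{(i)}\|$ for all $i\in I$. $C^k$ denotes the $k$-fold composition of $C$ with itself. Auxiliary operator: $A(x)=\frac1m\sum_{i=1}^m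 A_i(x)$, where $A_1=\frac12(\mathrm{Id}+P_{U_1})$ and $A_i=\frac12(\mathrm{Id}+P_{U_i}R_{U_{i-1}}\cdots R_{U_1})$ for $i=2,\dots,m$. A sequence $\{y_k\}$ converges to $y$ with the linear rate $r\in[0,1)$ if there is $M\ge 0$ with $\|y_k-y\|\le M r^k$ for all $k$. *)

theory Defs
  imports "HOL-Analysis.Analysis"
begin

text \<open>
  For a linear subspace the condition is equivalent to \<open>x - p\<close> being orthogonal to all of \<open>V\<close>;
  the form with differences \<open>v - p\<close> covers affine subspaces as well.
\<close>
definition orth_proj :: "'a::euclidean_space set \<Rightarrow> 'a \<Rightarrow> 'a" where
  "orth_proj V x = (THE p. p \<in> V \<and> (\<forall>v\<in>V. orthogonal (x - p) (v - p)))"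

definition reflection :: "'a::euclidean_space set \<Rightarrow> 'a \<Rightarrow> 'a" where
  "reflection V x = 2 *\<^sub>R orth_proj V x - x"

text \<open>\<open>refl_iter U i x\<close> is \<open>x\<^sup>(\<^sup>i\<^sup>) = R\<^bsub>U i\<^esub> \<dots> R\<^bsub>U 1\<^esub> x\<close>; the family is indexed from 1, and the index 0 gives \<open>x\<close> itself.\<close>
fun refl_iter :: "(nat \<Rightarrow> 'a::euclidean_space set) \<Rightarrow> nat \<Rightarrow> 'a \<Rightarrow> 'a" where
  "refl_iter U 0 x = x"
| "refl_iter U (Suc i) x = reflection (U (Suc i)) (refl_iter U i x)"

definition refl_hull :: "(nat \<Rightarrow> 'a::euclidean_space set) \<Rightarrow> nat \<Rightarrow> 'a \<Rightarrow> 'a set" where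
  "refl_hull U m x = affine hull (insert x ((\<lambda>i. refl_iter U i x) ` {1..m}))"

definition circum_refl :: "(nat \<Rightarrow> 'a::euclidean_space set) \<Rightarrow> nat \<Rightarrow> 'a \<Rightarrow> 'a" where
  "circum_refl U m x =
     (THE c. c \<in> refl_hull U m x \<and> (\<forall>i\<in>{1..m}. norm (c - x) = norm (c - refl_iter U i x)))"

text \<open>For \<open>i = 1\<close> the product of reflections is empty, so this is \<open>(x + P\<^bsub>U 1\<^esub> x) / 2\<close>.\<close>
definition aux_component :: "(nat \<Rightarrow> 'a::euclidean_space set) \<Rightarrow> nat \<Rightarrow> 'a \<Rightarrow> 'a" where
  "aux_component U i x = (1/2) *\<^sub>R (x + orth_proj (U i) (refl_iter U (i - 1) x))"

definition aux_operator :: "(nat \<Rightarrow> 'a::euclidean_space set) \<Rightarrow> nat \<Rightarrow> 'a \<Rightarrow> 'a" where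
  "aux_operator U m x = (1 / real m) *\<^sub>R (\<Sum>i = 1..m. aux_component U i x)"

definition converges_with_linear_rate ::
    "(nat \<Rightarrow> 'a::real_normed_vector) \<Rightarrow> 'a \<Rightarrow> real \<Rightarrow> bool" where
  "converges_with_linear_rate y l r \<longleftrightarrow>
     0 \<le> r \<and> r < 1 \<and> (\<exists>M\<ge>0. \<forall>k. norm (y k - l) \<le> M * r ^ k)"


subsection \<open>Well-definedness of the definite descriptions\<close>

lemma orth_proj_ex1:
  fixes V :: "'a::euclidean_space set"
  assumes "affine V" "V \<noteq> {}"
  shows "\<exists>!p. p \<in> V \<and> (\<forall>v\<in>V. orthogonal (x - p) (v - p))"
proof -
  obtain a where a: "a \<in> V" using assms(2) by auto
  define T where "T = (\<lambda>v. v - a) ` V"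
  have T: "subspace T"
    using affine_diffs_subspace_subtract[OF assms(1) a] by (simp add: T_def)
  obtain y z where yz: "y \<in> span T" "\<And>w. w \<in> span T \<Longrightarrow> orthogonal z w" "x - a = y + z"
    by (rule orthogonal_subspace_decomp_exists[of T "x - a"]) (rule that)
  have sT: "span T = T" using T by (simp add: span_eq_iff)
  have "y \<in> T" using yz(1) sT by simp
  then have pV: "a + y \<in> V" by (auto simp: T_def)
  have "orthogonal (x - (a + y)) (v - (a + y))" if "v \<in> V" for v
  proof -
    have "v - a \<in> T" using that by (auto simp: T_def)
    then have "(v - a) - y \<in> T" using T yz(1) sT by (simp add: subspace_diff)
    then have "orthogonal z ((v - a) - y)" using yz(2) sT by blast
    moreover have "z = x - (a + y)" using yz(3) by (simp add: algebra_simps)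
    ultimately show ?thesis by (simp add: algebra_simps)
  qed
  moreover have "p = q"
    if "p \<in> V" "q \<in> V" "\<forall>v\<in>V. orthogonal (x - p) (v - p)" "\<forall>v\<in>V. orthogonal (x - q) (v - q)"
    for p q
  proof -
    have "(x - p) \<bullet> (q - p) = 0" "(x - q) \<bullet> (p - q) = 0"
      using that by (auto simp: orthogonal_def)
    then have "(q - p) \<bullet> (q - p) = 0"
      by (simp add: inner_diff_left inner_diff_right inner_commute)
    then show ?thesis by simp
  qed
  ultimately show ?thesis using pV by (intro ex1I[of _ "a + y"]) simp_all
qed

lemma orth_proj:
  fixes V :: "'a::euclidean_space set"
  assumes "affine V" "V \<noteq> {}"
  shows orth_proj_in: "orth_proj V x \<in> V"
    and orth_proj_orthogonal: "v \<in> V \<Longrightarrow> orthogonal (x - orth_proj V x) (v - orth_proj V x)"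
  using theI'[OF orth_proj_ex1[OF assms, of x]] unfolding orth_proj_def by blast+

lemma orth_proj_eq_closest_point:
  fixes V :: "'a::euclidean_space set"
  assumes "affine V" "V \<noteq> {}"
  shows "orth_proj V x = closest_point V x"
proof (rule closest_point_unique)
  let ?p = "orth_proj V x"
  show "convex V" using assms(1) by (rule affine_imp_convex)
  have "affine hull V = V" using assms(1) by (simp only: affine_hull_eq)
  then show "closed V" by (metis closed_affine_hull)
  show "?p \<in> V" by (rule orth_proj_in[OF assms])
  show "\<forall>z\<in>V. dist x ?p \<le> dist x z"
  proof
    fix z assume "z \<in> V"
    then have "(x - ?p) \<bullet> (z - ?p) = 0"
      using orth_proj_orthogonal[OF assms] by (simp add: orthogonal_def)
    then have "(norm (x - z))\<^sup>2 = (norm (x - ?p))\<^sup>2 + (norm (z - ?p))\<^sup>2"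
      unfolding power2_norm_eq_inner
      by (simp add: inner_diff_left inner_diff_right inner_commute)
    then have "(norm (x - ?p))\<^sup>2 \<le> (norm (x - z))\<^sup>2" by simp
    then show "dist x ?p \<le> dist x z"
      unfolding dist_norm by (rule power2_le_imp_le) (rule norm_ge_zero)
  qed
qed

lemma norm_reflection:
  fixes V :: "'a::euclidean_space set"
  assumes "subspace V"
  shows "norm (reflection V x) = norm x"
proof -
  let ?p = "orth_proj V x"
  have V: "affine V" "V \<noteq> {}" "0 \<in> V"
    using assms subspace_imp_affine subspace_0 by auto
  have "(x - ?p) \<bullet> ?p = 0"
    using orth_proj_orthogonal[OF V(1,2) V(3), of x] by (simp add: orthogonal_def)
  then have "(norm (reflection V x))\<^sup>2 = (norm x)\<^sup>2"
    unfolding power2_norm_eq_inner reflection_def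
    by (simp add: inner_diff_left inner_diff_right inner_commute)
  then show ?thesis by simp
qed

lemma norm_refl_iter:
  assumes "\<And>i. i \<in> {1..m} \<Longrightarrow> subspace (U i)" "i \<le> m"
  shows "norm (refl_iter U i x) = norm x"
  using assms(2) by (induction i) (auto simp: norm_reflection assms(1))

lemma circum_refl_ex1:
  assumes U: "\<And>i. i \<in> {1..m} \<Longrightarrow> subspace (U i)"
  shows "\<exists>!c. c \<in> refl_hull U m x \<and> (\<forall>i\<in>{1..m}. norm (c - x) = norm (c - refl_iter U i x))"
proof -
  let ?P = "insert x ((\<lambda>i. refl_iter U i x) ` {1..m})"
  let ?W = "refl_hull U m x"
  define c where "c = orth_proj ?W 0"
  have W: "affine ?W" "?W \<noteq> {}" by (auto simp: refl_hull_def)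
  have cW: "c \<in> ?W" unfolding c_def by (rule orth_proj_in[OF W])
  have sq: "(norm (c - w))\<^sup>2 = (norm w)\<^sup>2 - (norm c)\<^sup>2" if "w \<in> ?W" for w
  proof -
    have "(0 - c) \<bullet> (w - c) = 0"
      using orth_proj_orthogonal[OF W that, of 0] by (simp add: c_def orthogonal_def)
    then show ?thesis
      unfolding power2_norm_eq_inner
      by (simp add: inner_diff_left inner_diff_right inner_commute)
  qed
  have mem: "w \<in> ?W" if "w \<in> ?P" for w
    using that unfolding refl_hull_def by (rule hull_inc)
  have "norm (c - x) = norm (c - refl_iter U i x)" if i: "i \<in> {1..m}" for i
  proof -
    have "norm (refl_iter U i x) = norm x" using norm_refl_iter[of m U i x] U i by auto
    then have "(norm (c - x))\<^sup>2 = (norm (c - refl_iter U i x))\<^sup>2"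
      using sq[of x] sq[of "refl_iter U i x"] mem i by auto
    then show ?thesis by simp
  qed
  moreover have "p = q"
    if p: "p \<in> ?W" "\<forall>i\<in>{1..m}. norm (p - x) = norm (p - refl_iter U i x)"
      and q: "q \<in> ?W" "\<forall>i\<in>{1..m}. norm (q - x) = norm (q - refl_iter U i x)" for p q
  proof -
    define H where "H = {w. (p - q) \<bullet> w = (p - q) \<bullet> x}"
    have "(p - q) \<bullet> refl_iter U i x = (p - q) \<bullet> x" if "i \<in> {1..m}" for i
    proof -
      have "(norm (p - x))\<^sup>2 = (norm (p - refl_iter U i x))\<^sup>2"
           "(norm (q - x))\<^sup>2 = (norm (q - refl_iter U i x))\<^sup>2"
        using p(2) q(2) that by auto
      then show ?thesis
        unfolding power2_norm_eq_inner
        by (simp add: inner_diff_left inner_diff_right inner_commute)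
    qed
    then have "?P \<subseteq> H" by (auto simp: H_def)
    moreover have "affine H" unfolding H_def by (rule affine_hyperplane)
    ultimately have "?W \<subseteq> H" unfolding refl_hull_def by (rule hull_minimal)
    then have "p \<in> H" "q \<in> H" using p(1) q(1) by blast+
    then have "(p - q) \<bullet> p = (p - q) \<bullet> q" unfolding H_def mem_Collect_eq by argo
    then have "(p - q) \<bullet> (p - q) = 0" by (simp add: inner_diff_right)
    then show ?thesis by simp
  qed
  ultimately show ?thesis using cW by (intro ex1I[of _ c]) simp_all
qed

end

theory Submission
  imports Defs
begin

text \<open>
  Write \<open>S\<close> for the intersection of the \<open>U i\<close>. Two facts drive the proof.

  First, a step of \<open>C\<close> is at least as good as a step of \<open>A\<close>. Reflections onto subspaces containing
  \<open>s\<close> preserve the distance to \<open>s\<close>, so for \<open>s \<in> S\<close> all the points \<open>x\<^sup>(\<^sup>i\<^sup>)\<close> lie on one sphere around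
  \<open>s\<close>. By Pythagoras the projection of \<open>s\<close> onto the affine hull \<open>W\<close> of these points is then
  equidistant to them, hence it is \<open>C x\<close> (\<open>circum_refl_eq_orth_proj\<close>): the circumcenter is
  the point of \<open>W\<close> closest to \<open>s\<close>, for every \<open>s \<in> S\<close> simultaneously. Since
  \<open>P\<^bsub>U i\<^esub> x\<^sup>(\<^sup>i\<^sup>-\<^sup>1\<^sup>)\<close> is the midpoint of \<open>x\<^sup>(\<^sup>i\<^sup>-\<^sup>1\<^sup>)\<close> and \<open>x\<^sup>(\<^sup>i\<^sup>)\<close>, the point \<open>A x\<close> lies in \<open>W\<close> as well,
  so \<open>C x\<close> is no farther from \<open>s\<close> than \<open>A x\<close> is. Moreover, \<open>x - C x\<close> is a direction of
  \<open>W\<close>, hence orthogonal to \<open>C x - s\<close> for every \<open>s \<in> S\<close>, hence to \<open>S\<close>; so \<open>C\<close> does not change the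
  projection onto \<open>S\<close>, and the estimate can be iterated with the fixed point \<open>s = P\<^bsub>S\<^esub> x\<close>.

  Second, \<open>A\<close> contracts towards \<open>S\<close> (\<open>aux_operator_contraction\<close>). It is linear, fixes every point of \<open>S\<close> and strictly
  decreases the norm outside \<open>S\<close>: the summand \<open>A\<^sub>i y\<close> is the midpoint of \<open>y\<close> and a point of \<open>U i\<close>
  that is no longer than \<open>y\<close>, so if \<open>y \<notin> U i\<close> it is shorter than \<open>y\<close> by strict convexity of the norm. By
  compactness of the unit sphere of the orthogonal complement of \<open>S\<close> the strict decrease is uniform.
\<close>

section \<open>Projections and reflections\<close>

lemma orth_proj_subspace_inner:
  fixes V :: "'a::euclidean_space set"
  assumes V: "subspace V" and "v \<in> V"
  shows "(x - orth_proj V x) \<bullet> v = 0"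
proof -
  have "affine V" "V \<noteq> {}" using V subspace_imp_affine subspace_0 by auto
  moreover have "v + orth_proj V x \<in> V"
    using orth_proj_in[of V x] calculation assms subspace_add by blast
  ultimately show ?thesis
    using orth_proj_orthogonal[of V "v + orth_proj V x" x] by (simp add: orthogonal_def)
qed

lemma orth_proj_subspace_in:
  "subspace V \<Longrightarrow> orth_proj V x \<in> V" for V :: "'a::euclidean_space set"
  by (metis orth_proj_in subspace_imp_affine subspace_0 empty_iff)

lemma orth_proj_subspace_eqI:
  fixes V :: "'a::euclidean_space set"
  assumes V: "subspace V" and p: "p \<in> V" "\<And>v. v \<in> V \<Longrightarrow> (x - p) \<bullet> v = 0"
  shows "orth_proj V x = p"
proof -
  have "affine V" "V \<noteq> {}" using V subspace_imp_affine subspace_0 by auto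
  then have "\<exists>!p. p \<in> V \<and> (\<forall>v\<in>V. orthogonal (x - p) (v - p))" by (rule orth_proj_ex1)
  moreover have "\<forall>v\<in>V. orthogonal (x - p) (v - p)"
    using p V by (auto simp: orthogonal_def subspace_diff)
  ultimately show ?thesis unfolding orth_proj_def using p(1) by (intro the1_equality) auto
qed

lemma orth_proj_ident: "subspace V \<Longrightarrow> x \<in> V \<Longrightarrow> orth_proj V x = x"
  for V :: "'a::euclidean_space set"
  by (rule orth_proj_subspace_eqI) auto

lemma linear_orth_proj:
  fixes V :: "'a::euclidean_space set"
  assumes V: "subspace V"
  shows "linear (orth_proj V)"
proof (rule linearI)
  fix x y :: 'a and c :: real
  note V_simps = orth_proj_subspace_in[OF V] orth_proj_subspace_inner[OF V]
  show "orth_proj V (x + y) = orth_proj V x + orth_proj V y"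
  proof (rule orth_proj_subspace_eqI[OF V])
    fix v assume v: "v \<in> V"
    show "(x + y - (orth_proj V x + orth_proj V y)) \<bullet> v = 0"
      using V_simps(2)[OF v, of x] V_simps(2)[OF v, of y]
      by (simp add: inner_diff_left inner_add_left)
  qed (use V V_simps in \<open>auto intro: subspace_add\<close>)
  show "orth_proj V (c *\<^sub>R x) = c *\<^sub>R orth_proj V x"
  proof (rule orth_proj_subspace_eqI[OF V])
    fix v assume v: "v \<in> V"
    show "(c *\<^sub>R x - c *\<^sub>R orth_proj V x) \<bullet> v = 0"
      using V_simps(2)[OF v, of x] by (simp add: inner_diff_left)
  qed (use V V_simps in \<open>auto intro: subspace_scale\<close>)
qed

lemma norm_orth_proj_pythagoras:
  fixes V :: "'a::euclidean_space set"
  assumes V: "subspace V"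
  shows "(norm x)\<^sup>2 = (norm (orth_proj V x))\<^sup>2 + (norm (x - orth_proj V x))\<^sup>2"
  using orth_proj_subspace_inner[OF V orth_proj_subspace_in[OF V], of x x]
  unfolding power2_norm_eq_inner by (simp add: inner_diff_left inner_diff_right inner_commute)

lemma norm_orth_proj_le: "subspace V \<Longrightarrow> norm (orth_proj V x) \<le> norm x"
  for V :: "'a::euclidean_space set"
  by (rule power2_le_imp_le) (simp_all add: norm_orth_proj_pythagoras[of V x])

lemma linear_refl_iter:
  assumes "\<And>i. i \<in> {1..m} \<Longrightarrow> subspace (U i)" "i \<le> m"
  shows "linear (refl_iter U i)"
  using assms(2)
proof (induction i)
  case (Suc i)
  then have "linear (refl_iter U i)" "linear (orth_proj (U (Suc i)))"
    using linear_orth_proj assms(1) by auto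
  then show ?case
    by (intro linearI)
       (auto simp: reflection_def linear_add linear_cmul algebra_simps)
qed (auto intro: linearI)

lemma refl_iter_ident:
  assumes "\<And>j. j \<in> {1..i} \<Longrightarrow> subspace (U j)" "\<And>j. j \<in> {1..i} \<Longrightarrow> x \<in> U j"
  shows "refl_iter U i x = x"
  using assms
proof (induction i)
  case (Suc i)
  then show ?case by (auto simp: reflection_def orth_proj_ident scaleR_2)
qed auto

lemma norm_refl_iter_diff:
  assumes U: "\<And>i. i \<in> {1..m} \<Longrightarrow> subspace (U i)"
    and s: "s \<in> (\<Inter>i\<in>{1..m}. U i)" and i: "i \<le> m"
  shows "norm (refl_iter U i x - s) = norm (x - s)"
proof -
  have "refl_iter U i s = s" by (rule refl_iter_ident) (use U s i in auto)
  then have "refl_iter U i x - s = refl_iter U i (x - s)"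
    using linear_diff[OF linear_refl_iter[OF U i]] by simp
  also have "norm \<dots> = norm (x - s)" using norm_refl_iter[OF U i] by simp
  finally show ?thesis .
qed

section \<open>The circumcenter as a projection\<close>

lemma refl_hull_affine: "affine (refl_hull U m x)"
  by (simp add: refl_hull_def)

lemma refl_iter_in_refl_hull: "i \<le> m \<Longrightarrow> refl_iter U i x \<in> refl_hull U m x"
  unfolding refl_hull_def by (rule hull_inc, cases "i = 0") auto

text \<open>
  By Pythagoras, \<open>\<parallel>c - w\<parallel>\<^sup>2 = \<parallel>w - s\<parallel>\<^sup>2 - \<parallel>c - s\<parallel>\<^sup>2\<close> for the projection \<open>c\<close> of \<open>s\<close> onto the hull and
  every \<open>w\<close> in it. As the iterated reflections of \<open>x\<close> have a common distance to \<open>s\<close>, they have a common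
  distance to \<open>c\<close>, which is what defines the circumcenter.
\<close>
lemma circum_refl_eq_orth_proj:
  assumes U: "\<And>i. i \<in> {1..m} \<Longrightarrow> subspace (U i)"
    and s: "s \<in> (\<Inter>i\<in>{1..m}. U i)"
  shows "circum_refl U m x = orth_proj (refl_hull U m x) s"
proof -
  let ?W = "refl_hull U m x"
  define c where "c = orth_proj ?W s"
  have x: "x \<in> ?W" using refl_iter_in_refl_hull[of 0 m U x] by simp
  then have W: "affine ?W" "?W \<noteq> {}" using refl_hull_affine by auto
  have sq: "(norm (c - w))\<^sup>2 = (norm (w - s))\<^sup>2 - (norm (c - s))\<^sup>2" if "w \<in> ?W" for w
    using orth_proj_orthogonal[OF W that, of s]
    unfolding power2_norm_eq_inner c_def[symmetric] orthogonal_def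
    by (simp add: inner_diff_left inner_diff_right inner_commute)
  have "norm (c - x) = norm (c - refl_iter U i x)" if "i \<in> {1..m}" for i
  proof -
    have "(norm (c - x))\<^sup>2 = (norm (c - refl_iter U i x))\<^sup>2"
      using sq[OF x] sq[OF refl_iter_in_refl_hull] norm_refl_iter_diff[OF U s] that by auto
    then show ?thesis by simp
  qed
  moreover have "c \<in> ?W" unfolding c_def by (rule orth_proj_in[OF W])
  ultimately have "circum_refl U m x = c"
    unfolding circum_refl_def by (intro the1_equality circum_refl_ex1 U) auto
  then show ?thesis by (simp add: c_def)
qed

lemma circum_refl_orthogonal:
  assumes U: "\<And>i. i \<in> {1..m} \<Longrightarrow> subspace (U i)"
    and s: "s \<in> (\<Inter>i\<in>{1..m}. U i)" and w: "w \<in> refl_hull U m x"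
  shows "(s - circum_refl U m x) \<bullet> (w - circum_refl U m x) = 0"
proof -
  have "circum_refl U m x = orth_proj (refl_hull U m x) s"
    by (rule circum_refl_eq_orth_proj[OF U s])
  moreover have "refl_hull U m x \<noteq> {}" using w by blast
  ultimately show ?thesis
    using orth_proj_orthogonal[OF refl_hull_affine _ w, of s] by (simp add: orthogonal_def)
qed

lemma norm_circum_refl_le:
  assumes "\<And>i. i \<in> {1..m} \<Longrightarrow> subspace (U i)"
    and "s \<in> (\<Inter>i\<in>{1..m}. U i)" and "w \<in> refl_hull U m x"
  shows "norm (circum_refl U m x - s) \<le> norm (w - s)"
proof (rule power2_le_imp_le)
  let ?c = "circum_refl U m x"
  have "(norm (w - s))\<^sup>2 = (norm (w - ?c))\<^sup>2 + (norm (?c - s))\<^sup>2"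
    using circum_refl_orthogonal[OF assms]
    unfolding power2_norm_eq_inner
    by (simp add: inner_diff_left inner_diff_right inner_commute)
  then show "(norm (?c - s))\<^sup>2 \<le> (norm (w - s))\<^sup>2" by simp
qed simp

text \<open>
  Taking \<open>w = x\<close> and comparing \<open>s\<close> with \<open>0\<close> in the orthogonality relation shows that \<open>x - C x\<close> is
  orthogonal to the intersection.
\<close>
lemma orth_proj_circum_refl:
  assumes U: "\<And>i. i \<in> {1..m} \<Longrightarrow> subspace (U i)"
  shows "orth_proj (\<Inter>i\<in>{1..m}. U i) (circum_refl U m x) = orth_proj (\<Inter>i\<in>{1..m}. U i) x"
proof -
  let ?S = "\<Inter>i\<in>{1..m}. U i" and ?c = "circum_refl U m x"
  have S: "subspace ?S" using U by (intro subspace_Inter) auto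
  have x: "x \<in> refl_hull U m x" using refl_iter_in_refl_hull[of 0 m U x] by simp
  show ?thesis
  proof (rule orth_proj_subspace_eqI[OF S orth_proj_subspace_in[OF S]])
    fix s assume s: "s \<in> ?S"
    have "(s - ?c) \<bullet> (x - ?c) = 0" "(0 - ?c) \<bullet> (x - ?c) = 0"
      using circum_refl_orthogonal[OF U _ x] s subspace_0[OF S] by blast+
    then have "(x - ?c) \<bullet> s = 0" by (simp add: inner_diff_left inner_commute)
    then show "(?c - orth_proj ?S x) \<bullet> s = 0"
      using orth_proj_subspace_inner[OF S s, of x] by (simp add: inner_diff_left)
  qed
qed

section \<open>The averaged operator\<close>

lemma aux_component_eq:
  assumes "i \<ge> 1"
  shows "aux_component U i x =
    (1/2) *\<^sub>R x + (1/4) *\<^sub>R refl_iter U (i - 1) x + (1/4) *\<^sub>R refl_iter U i x"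
proof -
  obtain j where i: "i = Suc j" using assms by (cases i) auto
  define p where "p = orth_proj (U (Suc j)) (refl_iter U j x)"
  have "(1/4) *\<^sub>R (2 *\<^sub>R p) = (1/2) *\<^sub>R p" by simp
  then show ?thesis
    unfolding i p_def by (simp add: aux_component_def reflection_def algebra_simps)
qed

lemma aux_operator_in_refl_hull:
  assumes "m \<ge> 1"
  shows "aux_operator U m x \<in> refl_hull U m x"
proof -
  let ?W = "refl_hull U m x"
  have W: "convex ?W" using refl_hull_affine affine_imp_convex by blast
  have comp: "aux_component U i x \<in> ?W" if i: "i \<in> {1..m}" for i
  proof -
    let ?y = "refl_iter U (i - 1) x" and ?z = "refl_iter U i x"
    have "x \<in> ?W" "?y \<in> ?W" "?z \<in> ?W"
      using refl_iter_in_refl_hull[of 0 m U x] refl_iter_in_refl_hull[of _ m U x] i by auto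
    moreover from this have "(1/2) *\<^sub>R ?y + (1/2) *\<^sub>R ?z \<in> ?W"
      by (intro convexD[OF W]) auto
    ultimately have "(1/2) *\<^sub>R x + (1/2) *\<^sub>R ((1/2) *\<^sub>R ?y + (1/2) *\<^sub>R ?z) \<in> ?W"
      by (intro convexD[OF W]) auto
    then show ?thesis using i by (simp add: aux_component_eq scaleR_add_right add.assoc)
  qed
  have "(\<Sum>i\<in>{1..m}. (1 / real m) *\<^sub>R aux_component U i x) \<in> ?W"
    using assms by (intro convex_sum W comp) auto
  then show ?thesis by (simp add: aux_operator_def scaleR_sum_right)
qed

lemma linear_aux_operator:
  assumes U: "\<And>i. i \<in> {1..m} \<Longrightarrow> subspace (U i)"
  shows "linear (aux_operator U m)"
proof -
  have "linear (aux_component U i)" if "i \<in> {1..m}" for i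
  proof -
    have "linear (orth_proj (U i))" by (rule linear_orth_proj[OF U[OF that]])
    moreover have "linear (refl_iter U (i - 1))"
      by (rule linear_refl_iter[OF U]) (use that in auto)
    ultimately show ?thesis
      by (intro linearI) (auto simp: aux_component_def linear_add linear_cmul algebra_simps)
  qed
  then have "linear (\<lambda>x. \<Sum>i\<in>{1..m}. aux_component U i x)"
    by (intro linear_compose_sum) blast
  then show ?thesis unfolding aux_operator_def by (intro linear_compose_scale_right)
qed

lemma aux_operator_ident:
  assumes m: "m \<ge> 1" and U: "\<And>i. i \<in> {1..m} \<Longrightarrow> subspace (U i)"
    and s: "s \<in> (\<Inter>i\<in>{1..m}. U i)"
  shows "aux_operator U m s = s"
proof -
  have "aux_component U i s = s" if i: "i \<in> {1..m}" for i
  proof -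
    have "refl_iter U (i - 1) s = s" by (rule refl_iter_ident) (use U s i in auto)
    then show ?thesis
      using i U s by (simp add: aux_component_def orth_proj_ident flip: scaleR_2)
  qed
  then have "(\<Sum>i = 1..m. aux_component U i s) = real m *\<^sub>R s"
    by (simp add: sum_constant_scaleR)
  then show ?thesis using m by (simp add: aux_operator_def)
qed

lemma norm_orth_proj_refl_iter_le:
  assumes U: "\<And>i. i \<in> {1..m} \<Longrightarrow> subspace (U i)" and i: "i \<in> {1..m}"
  shows "norm (orth_proj (U i) (refl_iter U (i - 1) x)) \<le> norm x"
proof -
  have "norm (refl_iter U (i - 1) x) = norm x"
    by (rule norm_refl_iter[OF U]) (use i in auto)
  then show ?thesis using norm_orth_proj_le[OF U[OF i]] by metis
qed

lemma norm_aux_component_le: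
  assumes "\<And>i. i \<in> {1..m} \<Longrightarrow> subspace (U i)" and "i \<in> {1..m}"
  shows "norm (aux_component U i x) \<le> norm x"
proof -
  let ?p = "orth_proj (U i) (refl_iter U (i - 1) x)"
  have "norm ?p \<le> norm x" by (rule norm_orth_proj_refl_iter_le[OF assms])
  then show ?thesis using norm_triangle_ineq[of x ?p] by (simp add: aux_component_def)
qed

lemma norm_midpoint_less:
  fixes x p :: "'a::real_inner"
  assumes "norm p \<le> norm x" "p \<noteq> x"
  shows "norm ((1/2) *\<^sub>R (x + p)) < norm x"
proof -
  have "(norm (x + p))\<^sup>2 + (norm (x - p))\<^sup>2 = 2 * (norm x)\<^sup>2 + 2 * (norm p)\<^sup>2"
    unfolding power2_norm_eq_inner
    by (simp add: inner_diff_left inner_diff_right inner_add_left inner_add_right)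
  moreover have "(norm p)\<^sup>2 \<le> (norm x)\<^sup>2" using assms(1) by (simp add: power_mono)
  moreover have "0 < (norm (x - p))\<^sup>2" using assms(2) by simp
  ultimately have "(norm (x + p))\<^sup>2 < 4 * (norm x)\<^sup>2" by linarith
  then have "(norm (x + p))\<^sup>2 < (2 * norm x)\<^sup>2" by (simp add: power_mult_distrib)
  then have "norm (x + p) < 2 * norm x" by (rule power2_less_imp_less) simp
  then show ?thesis by simp
qed

text \<open>
  Any \<open>U i\<close> without \<open>y\<close> gives a shorter summand, wherever the earlier reflections have moved \<open>y\<close>:
  \<open>A\<^sub>i y\<close> averages \<open>y\<close> with a point of \<open>U i\<close>, which is therefore different from \<open>y\<close>.
\<close>
lemma norm_aux_operator_less:
  assumes U: "\<And>i. i \<in> {1..m} \<Longrightarrow> subspace (U i)"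
    and y: "y \<notin> (\<Inter>i\<in>{1..m}. U i)"
  shows "norm (aux_operator U m y) < norm y"
proof -
  obtain i where i: "i \<in> {1..m}" "y \<notin> U i" using y by blast
  have "orth_proj (U i) (refl_iter U (i - 1) y) \<noteq> y"
    using orth_proj_subspace_in[OF U[OF i(1)]] i(2) by metis
  then have less: "norm (aux_component U i y) < norm y"
    unfolding aux_component_def
    by (intro norm_midpoint_less norm_orth_proj_refl_iter_le[OF U i(1)])
  have "norm (\<Sum>i = 1..m. aux_component U i y) \<le> (\<Sum>i = 1..m. norm (aux_component U i y))"
    by (rule norm_sum)
  also have "\<dots> < (\<Sum>i = 1..m. norm y)"
    using norm_aux_component_le[OF U] less i(1) by (intro sum_strict_mono_ex1) auto
  finally show ?thesis using i(1) by (simp add: aux_operator_def field_simps)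
qed

text \<open>
  A linear map that strictly decreases the norm on the nonzero vectors of a subspace does so uniformly,
  because the unit sphere of the subspace is compact.
\<close>
lemma linear_strict_decrease_imp_contraction:
  fixes f :: "'a::euclidean_space \<Rightarrow> 'b::real_normed_vector"
  assumes f: "linear f" and V: "subspace V"
    and less: "\<And>z. z \<in> V \<Longrightarrow> z \<noteq> 0 \<Longrightarrow> norm (f z) < norm z"
  shows "\<exists>r. 0 \<le> r \<and> r < 1 \<and> (\<forall>z\<in>V. norm (f z) \<le> r * norm z)"
proof (cases "V \<subseteq> {0}")
  case True
  then have "\<forall>z\<in>V. norm (f z) \<le> 0 * norm z" using linear_0[OF f] by auto
  then show ?thesis by (intro exI[of _ 0]) auto
next
  case False
  let ?K = "sphere 0 1 \<inter> V"
  have unit: "(1 / norm z) *\<^sub>R z \<in> ?K" if "z \<in> V" "z \<noteq> 0" for z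
    using that V by (auto intro: subspace_scale)
  have "compact ?K" using closed_subspace[OF V] by (intro compact_Int_closed) auto
  moreover have "?K \<noteq> {}" using False unit by blast
  moreover have "continuous_on ?K (\<lambda>z. norm (f z))"
    using f by (intro continuous_on_norm linear_continuous_on linear_conv_bounded_linear[THEN iffD1])
  ultimately obtain z0 where z0: "z0 \<in> ?K" "\<forall>z\<in>?K. norm (f z) \<le> norm (f z0)"
    using continuous_attains_sup by blast
  have "norm (f z) \<le> norm (f z0) * norm z" if z: "z \<in> V" for z
  proof (cases "z = 0")
    case False
    then have "norm (f ((1 / norm z) *\<^sub>R z)) \<le> norm (f z0)" using z0(2) unit z by blast
    then show ?thesis using False by (simp add: linear_cmul[OF f] field_simps)
  qed (simp add: linear_0[OF f])
  moreover have "z0 \<noteq> 0" "norm z0 = 1" using z0(1) by auto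
  then have "norm (f z0) < 1" using less[of z0] z0(1) by auto
  ultimately show ?thesis by (intro exI[of _ "norm (f z0)"]) auto
qed

lemma aux_operator_contraction:
  fixes U :: "nat \<Rightarrow> 'a::euclidean_space set"
  assumes m: "m \<ge> 1" and U: "\<And>i. i \<in> {1..m} \<Longrightarrow> subspace (U i)"
  shows "\<exists>r. 0 \<le> r \<and> r < 1 \<and>
    (\<forall>y. norm (aux_operator U m y - orth_proj (\<Inter>i\<in>{1..m}. U i) y)
          \<le> r * norm (y - orth_proj (\<Inter>i\<in>{1..m}. U i) y))"
proof -
  let ?S = "\<Inter>i\<in>{1..m}. U i" and ?A = "aux_operator U m"
  have S: "subspace ?S" using U by (intro subspace_Inter) auto
  have A: "linear ?A" by (rule linear_aux_operator[OF U])
  have "norm (?A z) < norm z" if "z \<in> ?S\<^sup>\<bottom>" "z \<noteq> 0" for z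
  proof (rule norm_aux_operator_less[OF U])
    show "z \<notin> ?S" using that unfolding orthogonal_comp_def orthogonal_def by force
  qed
  then obtain r where r: "0 \<le> r" "r < 1" "\<forall>z\<in>?S\<^sup>\<bottom>. norm (?A z) \<le> r * norm z"
    using linear_strict_decrease_imp_contraction[OF A subspace_orthogonal_comp] by blast
  have "norm (?A y - orth_proj ?S y) \<le> r * norm (y - orth_proj ?S y)" for y
  proof -
    have "?A y - orth_proj ?S y = ?A (y - orth_proj ?S y)"
      using aux_operator_ident[OF m U orth_proj_subspace_in[OF S]] linear_diff[OF A] by simp
    moreover have "y - orth_proj ?S y \<in> ?S\<^sup>\<bottom>"
      using orth_proj_subspace_inner[OF S]
      by (auto simp: orthogonal_comp_def orthogonal_def inner_commute)
    ultimately show ?thesis using r(3) by simp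
  qed
  then show ?thesis using r(1,2) by blast
qed

section \<open>Linear convergence\<close>

theorem theorem3p3:
  fixes U :: "nat \<Rightarrow> (real ^ 'n) set" and m :: nat
  assumes "m \<ge> 1"
    and "\<And>i. i \<in> {1..m} \<Longrightarrow> subspace (U i)"
  shows "\<exists>r. 0 \<le> r \<and> r < 1 \<and>
    (\<forall>y. norm (aux_operator U m y - orth_proj (\<Inter>i\<in>{1..m}. U i) y)
          \<le> r * norm (y - orth_proj (\<Inter>i\<in>{1..m}. U i) y)) \<and>
    (\<forall>x. converges_with_linear_rate (\<lambda>k. (circum_refl U m ^^ k) x)
          (orth_proj (\<Inter>i\<in>{1..m}. U i) x) r)"
proof -
  let ?P = "orth_proj (\<Inter>i\<in>{1..m}. U i)" and ?C = "circum_refl U m"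
  have S: "subspace (\<Inter>i\<in>{1..m}. U i)" using assms(2) by (intro subspace_Inter) auto
  obtain r where r: "0 \<le> r" "r < 1"
    and contr: "\<And>y. norm (aux_operator U m y - ?P y) \<le> r * norm (y - ?P y)"
    using aux_operator_contraction[of m U] assms by blast
  have step: "norm (?C x - ?P x) \<le> r * norm (x - ?P x)" for x
    using norm_circum_refl_le[OF assms(2) orth_proj_subspace_in[OF S]
        aux_operator_in_refl_hull[OF assms(1)]] contr order_trans by blast
  have P_step: "?P (?C x) = ?P x" for x by (rule orth_proj_circum_refl[OF assms(2)])
  have P_iter: "?P ((?C ^^ k) x) = ?P x" for k x
    by (induction k) (simp_all only: P_step funpow.simps o_apply id_apply)
  have "norm ((?C ^^ k) x - ?P x) \<le> norm (x - ?P x) * r ^ k" for k x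
  proof (induction k)
    case (Suc k)
    have "norm ((?C ^^ Suc k) x - ?P x) \<le> r * norm ((?C ^^ k) x - ?P x)"
      using step[of "(?C ^^ k) x"] by (simp only: P_iter funpow.simps o_apply)
    also have "\<dots> \<le> r * (norm (x - ?P x) * r ^ k)" using Suc r(1) by (rule mult_left_mono)
    finally show ?case by (simp add: mult_ac)
  qed simp
  then have "converges_with_linear_rate (\<lambda>k. (?C ^^ k) x) (?P x) r" for x
    unfolding converges_with_linear_rate_def using r norm_ge_zero by blast
  then show ?thesis using r contr by blast
qed

end
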